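(* Let $G$ be an $r_1$-regular graph with $n$ vertices and $m$ edges, and let $H_1,H_2,\ldots,H_m$ be $r_2$-regular graphs, each with $q$ vertices. Then for any real $\alpha\in[0,1]$, the $A_\alpha$-characteristic polynomial of the generalized edge corona $G[H_i]_1^m$ is $$f_{A_\alpha(G[H_i]_1^m)}(\lambda)=\frac{1}{(\lambda-2\alpha-r_2)^n}\prod_{i=1}^m f_{A_\alpha(H_i)}(\lambda-2\alpha)\cdot\prod_{j=1}^n\Big(\lambda^2-\big(2\alpha+r_2+\alpha r_1(q+1)+(1-\alpha)\lambda_j\big)\lambda+(2\alpha+r_2)\big(\alpha r_1(q+1)+(1-\alpha)\lambda_j\big)-q(1-\alpha)^2(r_1+\lambda_j)\Big),$$ where $\lambda_1\le\lambda_2\le\cdots\le\lambda_n=r_1$ are the eigenvalues of the adjacency matrix $A(G)$.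
   Context: All graphs are finite, simple and undirected. For a graph $G$ with adjacency matrix $A(G)$ and diagonal degree matrix $D(G)$, and real $\alpha\in[0,1]$, $A_\alpha(G)=\alpha D(G)+(1-\alpha)A(G)$. For a square matrix $U$ of order $n$, $f_U(\lambda)=\det(\lambda I_n-U)$. For a graph $G$ with $m$ edges $e_1,\ldots,e_m$ and graphs $H_1,\ldots,H_m$, the generalized edge corona $G[H_i]_1^m$ is the graph obtained by taking one copy of each of $G,H_1,\ldots,H_m$ (pairwise disjoint) and joining both end-vertices of the $i$th edge $e_i$ of $G$ to every vertex of $H_i$, for $1\le i\le m$. Identities are identities of rational functions in $\lambda$. *)

theory Defs
  imports
    "Jordan_Normal_Form.Char_Poly"
    "HOL-Computational_Algebra.Polynomial_Factorial"
begin

record 'a graph =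
  verts :: "'a set"
  edges :: "'a set set"

definition simple_graph :: "'a graph \<Rightarrow> bool" where
  "simple_graph G \<longleftrightarrow> finite (verts G) \<and> (\<forall>e\<in>edges G. e \<subseteq> verts G \<and> card e = 2)"

definition vdeg :: "'a graph \<Rightarrow> 'a \<Rightarrow> nat" where
  "vdeg G v = card {e \<in> edges G. v \<in> e}"

definition regular :: "nat \<Rightarrow> 'a graph \<Rightarrow> bool" where
  "regular r G \<longleftrightarrow> (\<forall>v\<in>verts G. vdeg G v = r)"

text \<open>
  Matrices of a graph are written down with respect to an arbitrary but fixed ordering of the
  vertices; another ordering gives a permutation-similar matrix, hence the same characteristic
  polynomial and the same eigenvalues.
\<close>

definition vertex_list :: "'a graph \<Rightarrow> 'a list" where
  "vertex_list G = (SOME vs. distinct vs \<and> set vs = verts G)"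

definition adj_matrix :: "'a graph \<Rightarrow> real mat" where
  "adj_matrix G = mat (card (verts G)) (card (verts G))
     (\<lambda>(i, j). if {vertex_list G ! i, vertex_list G ! j} \<in> edges G then 1 else 0)"

definition degree_matrix :: "'a graph \<Rightarrow> real mat" where
  "degree_matrix G = mat (card (verts G)) (card (verts G))
     (\<lambda>(i, j). if i = j then real (vdeg G (vertex_list G ! i)) else 0)"

definition A_alpha :: "real \<Rightarrow> 'a graph \<Rightarrow> real mat" where
  "A_alpha \<alpha> G = \<alpha> \<cdot>\<^sub>m degree_matrix G + (1 - \<alpha>) \<cdot>\<^sub>m adj_matrix G"

text \<open>
  The eigenvalues of the adjacency matrix with algebraic multiplicity, in nondecreasing order;
  \<open>adj_eigenvalue G j\<close> counts from \<open>j = 1\<close>.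
\<close>

definition adj_eigenvalues :: "'a graph \<Rightarrow> real list" where
  "adj_eigenvalues G = sorted_list_of_multiset (proots (char_poly (adj_matrix G)))"

definition adj_eigenvalue :: "'a graph \<Rightarrow> nat \<Rightarrow> real" where
  "adj_eigenvalue G j = adj_eigenvalues G ! (j - 1)"

text \<open>
  In \<open>edge_corona G m e H\<close> the map \<open>e\<close> enumerates the edges of \<open>G\<close> by \<open>{1..m}\<close>. The tags
  \<open>Inl\<close> and \<open>Inr (i, _)\<close> make the copies of \<open>G\<close> and of the \<open>H i\<close> pairwise disjoint.
\<close>

definition edge_corona ::
    "'a graph \<Rightarrow> nat \<Rightarrow> (nat \<Rightarrow> 'a set) \<Rightarrow> (nat \<Rightarrow> 'b graph) \<Rightarrow> ('a + nat \<times> 'b) graph" where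
  "edge_corona G m e H =
     \<lparr> verts = Inl ` verts G \<union> (\<Union>i\<in>{1..m}. (\<lambda>v. Inr (i, v)) ` verts (H i)),
       edges = (\<lambda>d. Inl ` d) ` edges G
             \<union> (\<Union>i\<in>{1..m}. (\<lambda>d. (\<lambda>v. Inr (i, v)) ` d) ` edges (H i))
             \<union> {{Inl u, Inr (i, v)} | u i v. i \<in> {1..m} \<and> u \<in> e i \<and> v \<in> verts (H i)} \<rparr>"

end

theory Submission
  imports Defs
begin

text \<open>
  Order the vertices of the corona with those of \<open>G\<close> first and the copies of the \<open>H i\<close> after them.
  Then \<open>\<lambda> I - A\<^sub>\<alpha>\<close> is a block matrix \<open>[X, B; C, Y]\<close>. A vertex of \<open>H i\<close> has two neighbours in \<open>G\<close>, so \<open>Y\<close>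
  is block diagonal with blocks \<open>(\<lambda> - 2 \<alpha>) I - A\<^sub>\<alpha>(H i)\<close>, which produces the characteristic
  polynomials of the \<open>H i\<close> with shifted argument. A vertex of \<open>G\<close> has degree \<open>r\<^sub>1 (q + 1)\<close>, so
  \<open>X = (\<lambda> - \<alpha> r\<^sub>1 (q + 1)) I - (1 - \<alpha>) A(G)\<close>.
  
  All vertices of one \<open>H i\<close> see the same two vertices of \<open>G\<close>, and by regularity \<open>Y\<close> has constant row
  sum \<open>s = \<lambda> - 2 \<alpha> - r\<^sub>2\<close> on each block; hence \<open>Y C = s C\<close>. This replaces the inverse of \<open>Y\<close> in the
  Schur complement: \<open>s ^ n * det [X, B; C, Y] = det (s X - B C) * det Y\<close> (lemma
  \<open>indexed_det_eliminate\<close>). The product \<open>B C\<close> is \<open>q (1 - \<alpha>)\<^sup>2\<close> times the sum over the edges of \<open>G\<close> of the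
  all-ones matrix on the two ends, that is \<open>q (1 - \<alpha>)\<^sup>2 (r\<^sub>1 I + A(G))\<close> (lemma \<open>sum_incidence\<close>). So
  \<open>s X - B C\<close> is a linear expression in \<open>A(G)\<close>, and its determinant is the product of the values of
  that expression at the eigenvalues of \<open>A(G)\<close>; expanded, these are the quadratic factors of the
  theorem.
  
  The computation takes place at real points \<open>\<lambda>\<close>, and since it never divides by \<open>s\<close> it is valid at
  all of them, which gives an identity of polynomials. Dividing by \<open>s ^ n\<close> in the field of fractions
  comes last. That \<open>G\<close> has \<open>n\<close> real eigenvalues holds because \<open>A(G)\<close> is real and symmetric (lemma
  \<open>real_symmetric_char_poly_splits\<close>), and the largest is \<open>r\<^sub>1\<close> because its entries are
  nonnegative and all its row sums are \<open>r\<^sub>1\<close>.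
\<close>

section \<open>Determinants indexed by a list of labels\<close>

text \<open>
  The corona is a graph whose vertices come in natural blocks, but its matrix is written in an
  unknown vertex order. A kernel indexed by the vertices themselves, evaluated along any list of
  them, separates the two: the order can be changed at will, and block structure becomes a
  property of how the list is put together, with no index arithmetic.
\<close>
definition indexed_det :: "'i list \<Rightarrow> ('i \<Rightarrow> 'i \<Rightarrow> 'a :: comm_ring_1) \<Rightarrow> 'a" where
  "indexed_det xs M = det (mat (length xs) (length xs) (\<lambda>(i, j). M (xs ! i) (xs ! j)))"

lemma indexed_det_cong:
  assumes "\<And>x y. x \<in> set xs \<Longrightarrow> y \<in> set xs \<Longrightarrow> M x y = N x y"
  shows "indexed_det xs M = indexed_det xs N"
  unfolding indexed_det_def using assms by (intro arg_cong[of _ _ det] cong_mat) auto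

lemma indexed_det_map:
  "indexed_det (map f xs) M = indexed_det xs (\<lambda>x y. M (f x) (f y))"
  unfolding indexed_det_def length_map by (intro arg_cong[of _ _ det] cong_mat) auto

lemma indexed_det_Nil [simp]: "indexed_det [] M = 1"
  by (simp add: indexed_det_def)

lemma indexed_det_transpose:
  "indexed_det xs (\<lambda>x y. M y x) = indexed_det xs M"
proof -
  let ?n = "length xs"
  have "mat ?n ?n (\<lambda>(i, j). M (xs ! j) (xs ! i))
      = transpose_mat (mat ?n ?n (\<lambda>(i, j). M (xs ! i) (xs ! j)))"
    by (rule eq_matI) auto
  then show ?thesis
    unfolding indexed_det_def by (simp add: det_transpose[of _ ?n])
qed

text \<open>
  Passing from one ordering to the other permutes rows and columns by the same permutation, so
  its sign enters twice. The matrix \<open>half\<close> has only its rows permuted.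
\<close>
lemma indexed_det_reorder:
  assumes "mset xs = mset ys"
  shows "indexed_det xs M = indexed_det ys M"
proof -
  let ?n = "length ys"
  obtain p where p: "p permutes {..<?n}" and xs: "permute_list p ys = xs"
    using mset_eq_permutation[OF assms] .
  have p': "p permutes {0..<?n}" using p by (simp add: atLeast0LessThan)
  have len: "length xs = ?n" using assms by (rule mset_eq_length)
  have nth: "xs ! i = ys ! p i" if "i < ?n" for i
    using that p xs permute_list_nth by blast
  have plt: "p i < ?n" if "i < ?n" for i
    using that permutes_in_image[OF p] by auto
  define half where "half = mat ?n ?n (\<lambda>(i, j). M (xs ! i) (ys ! j))"
  have 1: "det half = signof p * indexed_det ys M"
  proof -
    have "half = mat ?n ?n (\<lambda>(i, j). mat ?n ?n (\<lambda>(i, j). M (ys ! i) (ys ! j)) $$ (p i, j))"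
      unfolding half_def by (rule eq_matI) (auto simp: nth plt)
    then show ?thesis
      unfolding indexed_det_def by (simp only: det_permute_rows[OF mat_carrier p'])
  qed
  have 2: "indexed_det xs M = signof p * det half"
  proof -
    have "transpose_mat (mat ?n ?n (\<lambda>(i, j). M (xs ! i) (xs ! j)))
        = mat ?n ?n (\<lambda>(i, j). transpose_mat half $$ (p i, j))"
      unfolding half_def by (rule eq_matI) (auto simp: nth plt)
    then have "det (transpose_mat (mat ?n ?n (\<lambda>(i, j). M (xs ! i) (xs ! j))))
        = signof p * det (transpose_mat half)"
      using det_permute_rows[OF _ p', of "transpose_mat half"] by (simp add: half_def)
    then show ?thesis
      unfolding indexed_det_def len
      by (simp add: det_transpose[of _ ?n] half_def)
  qed
  have "signof p * signof p = (1 :: 'b)" by (simp add: sign_def)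
  then show ?thesis
    unfolding 1 2 by (simp flip: mult.assoc)
qed

lemma indexed_det_append:
  fixes M :: "'i \<Rightarrow> 'i \<Rightarrow> 'a :: idom"
  assumes "\<And>x y. x \<in> set xs \<Longrightarrow> y \<in> set ys \<Longrightarrow> M y x = 0"
  shows "indexed_det (xs @ ys) M = indexed_det xs M * indexed_det ys M"
proof -
  let ?k = "length xs" and ?l = "length ys"
  have "mat (?k + ?l) (?k + ?l) (\<lambda>(i, j). M ((xs @ ys) ! i) ((xs @ ys) ! j))
      = four_block_mat (mat ?k ?k (\<lambda>(i, j). M (xs ! i) (xs ! j)))
          (mat ?k ?l (\<lambda>(i, j). M (xs ! i) (ys ! j))) (0\<^sub>m ?l ?k)
          (mat ?l ?l (\<lambda>(i, j). M (ys ! i) (ys ! j)))"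
    using assms by (intro eq_matI) (auto simp: nth_append)
  then show ?thesis
    unfolding indexed_det_def length_append
    by (simp add: det_four_block_mat_lower_left_zero[of _ ?k _ ?l])
qed

lemma indexed_det_concat:
  fixes M :: "'i \<Rightarrow> 'i \<Rightarrow> 'a :: idom"
  assumes "distinct ks"
    and "\<And>k l x y. k \<in> set ks \<Longrightarrow> l \<in> set ks \<Longrightarrow> k \<noteq> l \<Longrightarrow> x \<in> set (f k) \<Longrightarrow> y \<in> set (f l)
      \<Longrightarrow> M x y = 0"
  shows "indexed_det (concat (map f ks)) M = (\<Prod>k\<in>set ks. indexed_det (f k) M)"
  using assms
proof (induction ks)
  case (Cons k ks)
  have "indexed_det (f k @ concat (map f ks)) M
      = indexed_det (f k) M * indexed_det (concat (map f ks)) M"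
    using Cons.prems by (intro indexed_det_append) auto
  moreover have "indexed_det (concat (map f ks)) M = (\<Prod>k\<in>set ks. indexed_det (f k) M)"
    using Cons.prems by (intro Cons.IH) auto
  ultimately show ?case
    using Cons.prems(1) by simp
qed simp

lemma indexed_det_mult:
  assumes "distinct xs"
  shows "indexed_det xs (\<lambda>x y. \<Sum>z\<in>set xs. M x z * P z y) = indexed_det xs M * indexed_det xs P"
proof -
  let ?n = "length xs"
  let ?mat = "\<lambda>M. mat ?n ?n (\<lambda>(i, j). M (xs ! i) (xs ! j))"
  have sum: "(\<Sum>z\<in>set xs. g z) = (\<Sum>k = 0..<?n. g (xs ! k))" for g :: "'a \<Rightarrow> 'b"
    using sum.reindex_bij_betw[OF bij_betw_nth[OF assms refl refl], of g]
    by (simp add: atLeast0LessThan)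
  have "?mat (\<lambda>x y. \<Sum>z\<in>set xs. M x z * P z y) = ?mat M * ?mat P"
    by (rule eq_matI) (auto simp: sum scalar_prod_def)
  then show ?thesis
    unfolding indexed_det_def by (simp add: det_mult[of _ ?n])
qed

lemma indexed_det_scale:
  "indexed_det xs (\<lambda>x y. c * M x y) = c ^ length xs * indexed_det xs M"
proof -
  let ?n = "length xs"
  have "mat ?n ?n (\<lambda>(i, j). c * M (xs ! i) (xs ! j))
      = c \<cdot>\<^sub>m mat ?n ?n (\<lambda>(i, j). M (xs ! i) (xs ! j))"
    by (rule eq_matI) auto
  then show ?thesis unfolding indexed_det_def by simp
qed

lemma indexed_det_scalar:
  assumes "distinct xs"
  shows "indexed_det xs (\<lambda>x y. if x = y then c else 0) = c ^ length xs"
proof -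
  let ?n = "length xs"
  have "mat ?n ?n (\<lambda>(i, j). if xs ! i = xs ! j then c else 0) = c \<cdot>\<^sub>m 1\<^sub>m ?n"
    using assms by (intro eq_matI) (auto simp: nth_eq_iff_index_eq)
  then show ?thesis unfolding indexed_det_def by simp
qed

text \<open>
  A Schur complement that needs no inverse. The hypothesis says that every column of the
  lower left block \<open>C\<close> is an eigenvector, for the same value \<open>s\<close>, of the lower right block \<open>Y\<close>.
  Multiplying
  
    \<open>[X, B; C, Y]\<close>  on the right by  \<open>[s I, 0; - C, I]\<close>
  
  turns the lower left block into \<open>s C - Y C = 0\<close> and the upper left one into \<open>s X - B C\<close>. Since the
  second factor has determinant \<open>s\<close> to the number of upper rows, comparing determinants gives the
  claim, for singular \<open>Y\<close> and for \<open>s = 0\<close> as well.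
\<close>
lemma indexed_det_eliminate:
  fixes M :: "'i \<Rightarrow> 'i \<Rightarrow> 'a :: idom"
  assumes dist: "distinct (xs @ ys)"
    and eig: "\<And>x y. x \<in> set xs \<Longrightarrow> y \<in> set ys \<Longrightarrow> (\<Sum>z\<in>set ys. M y z * M z x) = s * M y x"
  shows "s ^ length xs * indexed_det (xs @ ys) M
    = indexed_det xs (\<lambda>u v. s * M u v - (\<Sum>z\<in>set ys. M u z * M z v)) * indexed_det ys M"
proof -
  \<comment> \<open>\<open>P\<close> is the right factor \<open>[s I, 0; - C, I]\<close> and \<open>N\<close> is the block triangular product.\<close>
  define P where "P = (\<lambda>z y. if y \<in> set xs then (if z \<in> set xs then (if z = y then s else 0) else - M z y)
      else (if z = y then 1 else 0))"
  define N where "N = (\<lambda>x y. \<Sum>z\<in>set (xs @ ys). M x z * P z y)"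
  have disj: "set xs \<inter> set ys = {}" using dist by auto
  have N_split: "N x y = (\<Sum>z\<in>set xs. M x z * P z y) + (\<Sum>z\<in>set ys. M x z * P z y)" for x y
    unfolding N_def using disj by (simp add: sum.union_disjoint)
  have N_left: "N x v = s * M x v - (\<Sum>z\<in>set ys. M x z * M z v)" if v: "v \<in> set xs" for x v
  proof -
    have "(\<Sum>z\<in>set xs. M x z * P z v) = (\<Sum>z\<in>set xs. if z = v then M x v * s else 0)"
      using v by (intro sum.cong) (auto simp: P_def)
    moreover have "(\<Sum>z\<in>set ys. M x z * P z v) = (\<Sum>z\<in>set ys. - (M x z * M z v))"
      using v disj by (intro sum.cong) (auto simp: P_def)
    ultimately show ?thesis
      using v unfolding N_split by (simp add: sum_negf mult.commute)
  qed
  have N_right: "N x v = M x v" if v: "v \<in> set ys" for x v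
  proof -
    have "(\<Sum>z\<in>set xs. M x z * P z v) = 0"
      using v disj by (intro sum.neutral) (auto simp: P_def)
    moreover have "(\<Sum>z\<in>set ys. M x z * P z v) = (\<Sum>z\<in>set ys. if z = v then M x v else 0)"
      using v disj by (intro sum.cong) (auto simp: P_def)
    ultimately show ?thesis
      using v unfolding N_split by simp
  qed
  have "indexed_det (xs @ ys) N = indexed_det xs N * indexed_det ys N"
    by (rule indexed_det_append) (simp add: N_left eig)
  also have "indexed_det xs N
      = indexed_det xs (\<lambda>u v. s * M u v - (\<Sum>z\<in>set ys. M u z * M z v))"
    by (intro indexed_det_cong N_left)
  also have "indexed_det ys N = indexed_det ys M"
    by (intro indexed_det_cong N_right)
  finally have N: "indexed_det (xs @ ys) N
      = indexed_det xs (\<lambda>u v. s * M u v - (\<Sum>z\<in>set ys. M u z * M z v)) * indexed_det ys M" .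
  \<comment> \<open>\<open>P\<close> vanishes in its upper right block, so it is the transpose that splits.\<close>
  have "indexed_det (xs @ ys) P = indexed_det (xs @ ys) (\<lambda>x y. P y x)"
    by (rule indexed_det_transpose[symmetric])
  also have "\<dots> = indexed_det xs (\<lambda>x y. P y x) * indexed_det ys (\<lambda>x y. P y x)"
    using disj by (intro indexed_det_append) (auto simp: P_def)
  also have "indexed_det xs (\<lambda>x y. P y x) = indexed_det xs (\<lambda>x y. if x = y then s else 0)"
    by (intro indexed_det_cong) (auto simp: P_def)
  also have "indexed_det ys (\<lambda>x y. P y x) = indexed_det ys (\<lambda>x y. if x = y then 1 else 0)"
    using disj by (intro indexed_det_cong) (auto simp: P_def)
  finally have P: "indexed_det (xs @ ys) P = s ^ length xs"
    using dist by (simp add: indexed_det_scalar)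
  have "indexed_det (xs @ ys) N = indexed_det (xs @ ys) M * indexed_det (xs @ ys) P"
    unfolding N_def using dist by (rule indexed_det_mult)
  with N P show ?thesis by (simp add: mult.commute)
qed

section \<open>Spectra of real symmetric matrices and of graphs\<close>

lemma poly_char_poly_indexed:
  fixes A :: "'i \<Rightarrow> 'i \<Rightarrow> 'a :: field"
  assumes "distinct xs" and "n = length xs"
  shows "poly (char_poly (mat n n (\<lambda>(i, j). A (xs ! i) (xs ! j)))) t
    = indexed_det xs (\<lambda>x y. (if x = y then t else 0) - A x y)"
proof -
  let ?A = "mat n n (\<lambda>(i, j). A (xs ! i) (xs ! j))"
  have "- char_matrix ?A t = mat n n (\<lambda>(i, j). (if xs ! i = xs ! j then t else 0) - A (xs ! i) (xs ! j))"
    using assms by (intro eq_matI) (auto simp: char_matrix_def nth_eq_iff_index_eq)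
  then show ?thesis
    using char_poly_matrix[of ?A n t] assms(2) unfolding indexed_det_def by simp
qed

text \<open>
  Over the complex numbers the characteristic polynomial splits. For an eigenvector \<open>v\<close> of a
  root \<open>k\<close>, the Hermitian form \<open>v\<^sup>* A v = k |v|\<^sup>2\<close> equals its own conjugate because \<open>A\<close> is real and
  symmetric; as \<open>|v|\<^sup>2 \<noteq> 0\<close>, every root \<open>k\<close> is real.
\<close>
lemma real_symmetric_char_poly_splits:
  fixes A :: "real mat"
  assumes A: "A \<in> carrier_mat n n"
    and sym: "\<And>i j. i < n \<Longrightarrow> j < n \<Longrightarrow> A $$ (i, j) = A $$ (j, i)"
  shows "\<exists>as. char_poly A = (\<Prod>a\<leftarrow>as. [:- a, 1:]) \<and> length as = n"
proof -
  let ?B = "map_mat complex_of_real A"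
  have B: "?B \<in> carrier_mat n n" using A by simp
  interpret map_complex: map_poly_inj_idom_hom complex_of_real ..
  obtain as where as: "char_poly ?B = (\<Prod>a\<leftarrow>as. [:- a, 1:])" "length as = n"
    using char_poly_factorized[OF B] by blast
  have real: "complex_of_real (Re k) = k" if k: "k \<in> set as" for k
  proof -
    have "poly (char_poly ?B) k = 0"
      unfolding as(1) using k by (auto simp: poly_prod_list prod_list_zero_iff image_iff o_def)
    then obtain v where v: "v \<in> carrier_vec n" "v \<noteq> 0\<^sub>v n" "?B *\<^sub>v v = k \<cdot>\<^sub>v v"
      using eigenvalue_root_char_poly[OF B] A unfolding eigenvalue_def eigenvector_def by auto
    have row: "(\<Sum>j<n. complex_of_real (A $$ (i, j)) * v $ j) = k * v $ i" if "i < n" for i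
    proof -
      have "(?B *\<^sub>v v) $ i = k * v $ i" using v that by simp
      then show ?thesis
        using v(1) A that by (simp add: mult_mat_vec_def scalar_prod_def atLeast0LessThan)
    qed
    let ?form = "\<Sum>i<n. \<Sum>j<n. cnj (v $ i) * (complex_of_real (A $$ (i, j)) * v $ j)"
    let ?sq = "\<Sum>i<n. (cmod (v $ i))\<^sup>2"
    have "?form = (\<Sum>i<n. cnj (v $ i) * (k * v $ i))"
      by (intro sum.cong refl) (simp add: row flip: sum_distrib_left)
    also have "\<dots> = k * complex_of_real ?sq"
      unfolding of_real_sum complex_norm_square sum_distrib_left
      by (intro sum.cong refl) (simp add: algebra_simps)
    finally have form: "?form = k * complex_of_real ?sq" .
    have "cnj ?form = (\<Sum>i<n. \<Sum>j<n. cnj (v $ j) * (complex_of_real (A $$ (j, i)) * v $ i))"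
      by (auto intro!: sum.cong simp: sym)
    also have "\<dots> = ?form" by (rule sum.swap)
    finally have "cnj k * complex_of_real ?sq = k * complex_of_real ?sq"
      unfolding form by simp
    moreover have "?sq \<noteq> 0"
    proof -
      obtain i where "i < n" "v $ i \<noteq> 0"
        using v(1,2) by (metis carrier_vecD eq_vecI index_zero_vec)
      then have "?sq > 0" by (intro sum_pos2[of _ i]) auto
      then show ?thesis by simp
    qed
    ultimately have "cnj k = k" by (metis mult_cancel_right of_real_eq_0_iff)
    then show ?thesis by (simp add: complex_eq_iff)
  qed
  have "map_poly complex_of_real (char_poly A) = char_poly ?B"
    by (rule of_real_hom.char_poly_hom[OF A, symmetric])
  also have "\<dots> = (\<Prod>a\<leftarrow>map Re as. [:- complex_of_real a, 1:])"
    unfolding as(1) using real by (auto intro!: arg_cong[of _ _ prod_list])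
  also have "\<dots> = map_poly complex_of_real (\<Prod>a\<leftarrow>map Re as. [:- a, 1:])"
    by (induction as) (auto simp: hom_distribs)
  finally have "char_poly A = (\<Prod>a\<leftarrow>map Re as. [:- a, 1:])"
    by (simp only: map_complex.eq_iff)
  with as(2) show ?thesis by (metis length_map)
qed


lemma vertex_list:
  assumes "finite (verts G)"
  shows "distinct (vertex_list G)" and "set (vertex_list G) = verts G"
    and "length (vertex_list G) = card (verts G)"
proof -
  have "\<exists>vs. distinct vs \<and> set vs = verts G"
    using finite_distinct_list[OF assms] by blast
  then have "distinct (vertex_list G) \<and> set (vertex_list G) = verts G"
    unfolding vertex_list_def by (rule someI_ex)
  then show "distinct (vertex_list G)" "set (vertex_list G) = verts G"
    "length (vertex_list G) = card (verts G)"
    by (auto simp: distinct_card[symmetric])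
qed

definition adj_entry :: "'a graph \<Rightarrow> 'a \<Rightarrow> 'a \<Rightarrow> real" where
  "adj_entry G u v = (if {u, v} \<in> edges G then 1 else 0)"

definition alpha_entry :: "real \<Rightarrow> 'a graph \<Rightarrow> 'a \<Rightarrow> 'a \<Rightarrow> real" where
  "alpha_entry \<alpha> G u v = (if u = v then \<alpha> * real (vdeg G u) else 0) + (1 - \<alpha>) * adj_entry G u v"

lemma simple_graphD:
  assumes "simple_graph G"
  shows "finite (verts G)" and "finite (edges G)"
    and "e \<in> edges G \<Longrightarrow> e \<subseteq> verts G" and "e \<in> edges G \<Longrightarrow> card e = 2"
proof -
  have "edges G \<subseteq> Pow (verts G)" using assms unfolding simple_graph_def by auto
  then show "finite (edges G)"
    using assms unfolding simple_graph_def by (meson finite_Pow_iff finite_subset)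
qed (use assms in \<open>auto simp: simple_graph_def\<close>)

lemma adj_matrix_indexed:
  "adj_matrix G = mat (card (verts G)) (card (verts G))
     (\<lambda>(i, j). adj_entry G (vertex_list G ! i) (vertex_list G ! j))"
  unfolding adj_matrix_def adj_entry_def ..

lemma A_alpha_indexed:
  assumes "finite (verts G)"
  shows "A_alpha \<alpha> G = mat (card (verts G)) (card (verts G))
     (\<lambda>(i, j). alpha_entry \<alpha> G (vertex_list G ! i) (vertex_list G ! j))"
  using vertex_list[OF assms]
  by (intro eq_matI)
     (auto simp: A_alpha_def degree_matrix_def adj_matrix_def alpha_entry_def adj_entry_def
        nth_eq_iff_index_eq)

lemma poly_char_poly_A_alpha:
  assumes "finite (verts G)"
  shows "poly (char_poly (A_alpha \<alpha> G)) t
    = indexed_det (vertex_list G) (\<lambda>u v. (if u = v then t else 0) - alpha_entry \<alpha> G u v)"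
  unfolding A_alpha_indexed[OF assms]
  using vertex_list[OF assms] by (intro poly_char_poly_indexed) auto

text \<open>
  The neighbours \<open>v\<close> of \<open>u\<close> correspond to the edges \<open>{u, v}\<close> at \<open>u\<close>, each of which has exactly two ends.
\<close>
lemma sum_adj_entry:
  assumes "simple_graph G"
  shows "(\<Sum>v\<in>verts G. adj_entry G u v) = real (vdeg G u)"
proof -
  note G = simple_graphD[OF assms]
  let ?N = "{v \<in> verts G. {u, v} \<in> edges G}"
  have "(\<lambda>v. {u, v}) ` ?N = {d \<in> edges G. u \<in> d}"
  proof (intro equalityI subsetI)
    fix d assume d: "d \<in> {d \<in> edges G. u \<in> d}"
    then obtain v where "d = {u, v}"
      using G(4)[of d] by (auto simp: card_2_iff)
    with d show "d \<in> (\<lambda>v. {u, v}) ` ?N" using G(3)[of d] by auto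
  qed auto
  moreover have "inj_on (\<lambda>v. {u, v}) ?N"
    by (auto simp: inj_on_def doubleton_eq_iff)
  ultimately have "card ?N = vdeg G u"
    unfolding vdeg_def by (metis (no_types, lifting) card_image)
  moreover have "(\<Sum>v\<in>verts G. adj_entry G u v) = real (card ?N)"
    using G(1) by (simp add: adj_entry_def sum.If_cases Int_def)
  ultimately show ?thesis by simp
qed

text \<open>
  This is the identity \<open>B B\<^sup>T = D + A\<close> for the vertex-edge incidence matrix \<open>B\<close>: the sum counts the
  edges containing both \<open>u\<close> and \<open>v\<close>.
\<close>
lemma sum_incidence:
  assumes "simple_graph G" and "bij_betw e {1..m} (edges G)"
  shows "(\<Sum>i=1..m. (if u \<in> e i then 1 else 0) * (if v \<in> e i then 1 else 0))
    = (if u = v then real (vdeg G u) else 0) + adj_entry G u v"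
proof -
  note G = simple_graphD[OF assms(1)]
  have "(\<Sum>i=1..m. (if u \<in> e i then 1 else 0) * (if v \<in> e i then 1 else 0 :: real))
      = (\<Sum>d\<in>edges G. (if u \<in> d then 1 else 0) * (if v \<in> d then 1 else 0))"
    by (rule sum.reindex_bij_betw[OF assms(2)])
  also have "\<dots> = (\<Sum>d\<in>edges G. if u \<in> d \<and> v \<in> d then 1 else 0)"
    by (intro sum.cong) auto
  also have "\<dots> = real (card {d \<in> edges G. u \<in> d \<and> v \<in> d})"
    using G(2) by (simp add: sum.If_cases Int_def)
  also have "\<dots> = (if u = v then real (vdeg G u) else 0) + adj_entry G u v"
  proof (cases "u = v")
    case True
    then show ?thesis
      using G(4)[of "{v, v}"] by (auto simp: vdeg_def adj_entry_def)
  next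
    case False
    have "d \<in> edges G \<and> u \<in> d \<and> v \<in> d \<longleftrightarrow> d = {u, v} \<and> {u, v} \<in> edges G" for d
      using G(4)[of d] False by (auto simp: card_2_iff insert_commute)
    then have "{d \<in> edges G. u \<in> d \<and> v \<in> d} = (if {u, v} \<in> edges G then {{u, v}} else {})"
      by auto
    then show ?thesis using False by (simp add: adj_entry_def)
  qed
  finally show ?thesis .
qed

lemma adj_char_poly_splits:
  assumes "simple_graph G"
  shows "char_poly (adj_matrix G) = (\<Prod>a\<leftarrow>adj_eigenvalues G. [:- a, 1:])"
    and "length (adj_eigenvalues G) = card (verts G)"
proof -
  let ?p = "char_poly (adj_matrix G)"
  obtain as where as: "?p = (\<Prod>a\<leftarrow>as. [:- a, 1:])" "length as = card (verts G)"
    using real_symmetric_char_poly_splits[of "adj_matrix G" "card (verts G)"]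
    by (auto simp: adj_matrix_def insert_commute)
  have "proots (\<Prod>a\<leftarrow>as. [:- a, 1:]) = mset as"
  proof (induction as)
    case (Cons a as)
    have "(\<Prod>a\<leftarrow>as. [:- a, 1:]) \<noteq> (0 :: real poly)" by (auto simp: prod_list_zero_iff)
    with Cons show ?case by (simp add: proots_mult del: mult_pCons_left)
  qed simp
  then have *: "mset (adj_eigenvalues G) = mset as"
    unfolding adj_eigenvalues_def as(1) by simp
  then show "length (adj_eigenvalues G) = card (verts G)"
    using as(2) mset_eq_length by metis
  have "mset (map (\<lambda>a. [:- a, 1:]) (adj_eigenvalues G)) = mset (map (\<lambda>a. [:- a, 1:]) as)"
    using * by simp
  then show "?p = (\<Prod>a\<leftarrow>adj_eigenvalues G. [:- a, 1:])"
    unfolding as(1) by (metis prod_mset_prod_list)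
qed

text \<open>
  Restates eigenvectors of the adjacency matrix as functions on the vertices, so that the two
  facts about the largest eigenvalue below can be argued on the graph.
\<close>
lemma eigenvalue_adj_iff:
  assumes "simple_graph G"
  shows "k \<in> set (adj_eigenvalues G) \<longleftrightarrow>
    (\<exists>x. (\<exists>u\<in>verts G. x u \<noteq> 0) \<and> (\<forall>u\<in>verts G. (\<Sum>v\<in>verts G. adj_entry G u v * x v) = k * x u))"
  (is "_ \<longleftrightarrow> (\<exists>x. ?ev x)")
proof -
  note G = simple_graphD[OF assms]
  note vl = vertex_list[OF G(1)]
  define n where "n = card (verts G)"
  let ?vs = "vertex_list G"
  have A: "adj_matrix G \<in> carrier_mat n n" by (simp add: adj_matrix_def n_def)
  have bij: "bij_betw ((!) ?vs) {..<n} (verts G)"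
    using bij_betw_nth[OF vl(1)] vl by (simp add: n_def)
  have sum: "(\<Sum>v\<in>verts G. g v) = (\<Sum>j<n. g (?vs ! j))" for g :: "'a \<Rightarrow> real"
    by (rule sum.reindex_bij_betw[OF bij, symmetric])
  have verts: "verts G = (!) ?vs ` {..<n}"
    using bij by (simp add: bij_betw_def)
  have "k \<in> set (adj_eigenvalues G) \<longleftrightarrow> poly (char_poly (adj_matrix G)) k = 0"
    unfolding adj_char_poly_splits(1)[OF assms]
    by (auto simp: poly_prod_list prod_list_zero_iff image_iff o_def)
  also have "\<dots> \<longleftrightarrow> eigenvalue (adj_matrix G) k"
    by (rule eigenvalue_root_char_poly[OF A, symmetric])
  also have "\<dots> \<longleftrightarrow> (\<exists>w. w \<in> carrier_vec n \<and> w \<noteq> 0\<^sub>v n \<and> adj_matrix G *\<^sub>v w = k \<cdot>\<^sub>v w)"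
    unfolding eigenvalue_def eigenvector_def using A by simp
  also have "\<dots> \<longleftrightarrow> (\<exists>x. ?ev x)"
  proof
    assume "\<exists>w. w \<in> carrier_vec n \<and> w \<noteq> 0\<^sub>v n \<and> adj_matrix G *\<^sub>v w = k \<cdot>\<^sub>v w"
    then obtain w where w: "w \<in> carrier_vec n" "w \<noteq> 0\<^sub>v n" "adj_matrix G *\<^sub>v w = k \<cdot>\<^sub>v w"
      by blast
    define x where "x = (\<lambda>u. w $ the_inv_into {..<n} ((!) ?vs) u)"
    have x: "x (?vs ! i) = w $ i" if "i < n" for i
      unfolding x_def using that bij by (simp add: the_inv_into_f_f bij_betw_def)
    have "(\<Sum>j<n. adj_entry G (?vs ! i) (?vs ! j) * w $ j) = k * w $ i" if i: "i < n" for i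
    proof -
      have "(adj_matrix G *\<^sub>v w) $ i = k * w $ i" using w i by simp
      then show ?thesis
        using w(1) i by (simp add: adj_matrix_indexed n_def[symmetric] scalar_prod_def atLeast0LessThan)
    qed
    moreover have "\<exists>i<n. w $ i \<noteq> 0"
      using w(1,2) by (metis carrier_vecD eq_vecI index_zero_vec)
    ultimately have "?ev x"
      unfolding sum unfolding verts by (auto simp: x)
    then show "\<exists>x. ?ev x" by blast
  next
    assume "\<exists>x. ?ev x"
    then obtain x where x: "?ev x" ..
    define w where "w = vec n (\<lambda>i. x (?vs ! i))"
    from x obtain i where i: "i < n" "x (?vs ! i) \<noteq> 0" unfolding verts by auto
    then have "w $ i \<noteq> 0\<^sub>v n $ i" by (simp add: w_def)
    then have "w \<noteq> 0\<^sub>v n" by auto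
    moreover have "adj_matrix G *\<^sub>v w = k \<cdot>\<^sub>v w"
    proof (rule eq_vecI)
      fix i assume "i < dim_vec (k \<cdot>\<^sub>v w)"
      then have i: "i < n" by (simp add: w_def)
      then have "?vs ! i \<in> verts G" unfolding verts by auto
      then have "(\<Sum>v\<in>verts G. adj_entry G (?vs ! i) v * x v) = k * x (?vs ! i)" using x by blast
      then show "(adj_matrix G *\<^sub>v w) $ i = (k \<cdot>\<^sub>v w) $ i"
        using i unfolding sum
        by (simp add: adj_matrix_indexed w_def n_def[symmetric] scalar_prod_def atLeast0LessThan)
    qed (simp add: w_def adj_matrix_def n_def)
    ultimately show "\<exists>w. w \<in> carrier_vec n \<and> w \<noteq> 0\<^sub>v n \<and> adj_matrix G *\<^sub>v w = k \<cdot>\<^sub>v w"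
      by (intro exI[of _ w]) (simp add: w_def)
  qed
  finally show ?thesis .
qed

text \<open>
  The constant function is an eigenvector, because each row of the adjacency matrix sums to \<open>r\<close>.
\<close>
lemma regular_eigenvalue_mem:
  assumes "simple_graph G" and "regular r G" and "verts G \<noteq> {}"
  shows "real r \<in> set (adj_eigenvalues G)"
  unfolding eigenvalue_adj_iff[OF assms(1)]
  using assms(2,3) sum_adj_entry[OF assms(1)]
  by (intro exI[of _ "\<lambda>_. 1"]) (auto simp: regular_def)

text \<open>
  At a vertex \<open>w\<close> where an eigenvector \<open>x\<close> is largest in absolute value, \<open>k x w\<close> is a sum of \<open>r\<close>
  values of \<open>x\<close>, none of which exceeds \<open>|x w|\<close> in absolute value.
\<close>
lemma regular_eigenvalue_le:
  assumes "simple_graph G" and "regular r G" and "k \<in> set (adj_eigenvalues G)"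
  shows "k \<le> real r"
proof -
  note G = simple_graphD[OF assms(1)]
  obtain x u where u: "u \<in> verts G" "x u \<noteq> 0"
    and x: "\<And>u. u \<in> verts G \<Longrightarrow> (\<Sum>v\<in>verts G. adj_entry G u v * x v) = k * x u"
    using assms(3) unfolding eigenvalue_adj_iff[OF assms(1)] by blast
  have "\<bar>x u\<bar> \<le> Max ((\<lambda>v. \<bar>x v\<bar>) ` verts G)"
    using G(1) u(1) by (intro Max_ge) auto
  moreover have "Max ((\<lambda>v. \<bar>x v\<bar>) ` verts G) \<in> (\<lambda>v. \<bar>x v\<bar>) ` verts G"
    using G(1) u(1) by (intro Max_in) auto
  ultimately obtain w where w: "w \<in> verts G" "\<bar>x w\<bar> = Max ((\<lambda>v. \<bar>x v\<bar>) ` verts G)" "\<bar>x w\<bar> > 0"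
    using u(2) by force
  have max: "\<bar>x v\<bar> \<le> \<bar>x w\<bar>" if "v \<in> verts G" for v
    unfolding w(2) using G(1) that by (intro Max_ge) auto
  have "k * \<bar>x w\<bar> \<le> \<bar>k * x w\<bar>" by (simp add: abs_mult mult_right_mono)
  also have "\<dots> = \<bar>\<Sum>v\<in>verts G. adj_entry G w v * x v\<bar>" using x[OF w(1)] by simp
  also have "\<dots> \<le> (\<Sum>v\<in>verts G. \<bar>adj_entry G w v * x v\<bar>)" by (rule sum_abs)
  also have "\<dots> \<le> (\<Sum>v\<in>verts G. adj_entry G w v * \<bar>x w\<bar>)"
    using max by (intro sum_mono) (simp add: adj_entry_def)
  also have "\<dots> = real r * \<bar>x w\<bar>"
    using sum_adj_entry[OF assms(1), of w] assms(2) w(1)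
    by (simp add: regular_def flip: sum_distrib_right)
  finally show ?thesis using w(3) by simp
qed

lemma regular_largest_eigenvalue:
  assumes "simple_graph G" and "regular r G" and "card (verts G) > 0"
  shows "adj_eigenvalue G (card (verts G)) = real r"
proof -
  let ?l = "adj_eigenvalues G" and ?n = "card (verts G)"
  have len: "length ?l = ?n" by (rule adj_char_poly_splits(2)[OF assms(1)])
  have sorted: "sorted ?l" unfolding adj_eigenvalues_def by (rule sorted_sorted_list_of_multiset)
  have "verts G \<noteq> {}" using assms(3) by auto
  then obtain i where i: "i < ?n" "?l ! i = real r"
    using regular_eigenvalue_mem[OF assms(1,2)] len by (auto simp: in_set_conv_nth)
  have "?l ! i \<le> ?l ! (?n - 1)" using sorted i(1) len by (intro sorted_nth_mono) auto
  moreover have "?l ! (?n - 1) \<in> set ?l" using len assms(3) by (intro nth_mem) simp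
  then have "?l ! (?n - 1) \<le> real r" by (rule regular_eigenvalue_le[OF assms(1,2)])
  ultimately show ?thesis using i(2) unfolding adj_eigenvalue_def by simp
qed

text \<open>
  For \<open>w \<noteq> 0\<close> the matrix \<open>c I - w A\<close> is \<open>w (c/w I - A)\<close>, whose determinant the characteristic
  polynomial of \<open>A\<close> gives.
\<close>
lemma indexed_det_adj_linear:
  assumes "simple_graph G"
  shows "indexed_det (vertex_list G) (\<lambda>u v. (if u = v then c else 0) - w * adj_entry G u v)
    = (\<Prod>a\<leftarrow>adj_eigenvalues G. c - w * a)"
proof -
  note vl = vertex_list[OF simple_graphD(1)[OF assms]]
  note len = adj_char_poly_splits(2)[OF assms]
  show ?thesis
  proof (cases "w = 0")
    case True
    have "(\<Prod>a\<leftarrow>as. c) = c ^ length as" for as :: "real list" by (induction as) auto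
    with True show ?thesis by (simp add: indexed_det_scalar vl len)
  next
    case False
    have "indexed_det (vertex_list G) (\<lambda>u v. (if u = v then c else 0) - w * adj_entry G u v)
        = indexed_det (vertex_list G) (\<lambda>u v. w * ((if u = v then c / w else 0) - adj_entry G u v))"
      using False by (intro indexed_det_cong) (auto simp: algebra_simps)
    also have "\<dots> = w ^ card (verts G) * poly (char_poly (adj_matrix G)) (c / w)"
      unfolding indexed_det_scale adj_matrix_indexed
      using vl by (subst poly_char_poly_indexed[of "vertex_list G"]) auto
    also have "\<dots> = w ^ length (adj_eigenvalues G) * (\<Prod>a\<leftarrow>adj_eigenvalues G. c / w - a)"
      unfolding adj_char_poly_splits(1)[OF assms] len by (simp add: poly_prod_list o_def)
    also have "\<dots> = (\<Prod>a\<leftarrow>adj_eigenvalues G. c - w * a)"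
    proof -
      have "w ^ length as * (\<Prod>a\<leftarrow>as. c / w - a) = (\<Prod>a\<leftarrow>as. c - w * a)" for as
      proof (induction as)
        case (Cons a as)
        have "w * (c / w - a) = c - w * a" using False by (simp add: field_simps)
        with Cons show ?case by (simp add: mult.assoc mult.left_commute) 
      qed simp
      then show ?thesis .
    qed
    finally show ?thesis .
  qed
qed

section \<open>The edge corona\<close>

lemma edge_corona_adj_base:
  fixes G :: "'a graph" and H :: "nat \<Rightarrow> 'b graph"
  shows "adj_entry (edge_corona G m e H) (Inl u) (Inl v) = adj_entry G u v"
proof -
  have "{Inl u, Inl v :: 'a + nat \<times> 'b} = Inl ` d \<longleftrightarrow> d = {u, v}" for d
    using inj_image_eq_iff[OF inj_Inl, of "{u, v}" d] by auto
  moreover have "{Inl u, Inl v} \<noteq> ((\<lambda>v. Inr (j, v)) ` d :: ('a + nat \<times> 'b) set)" for d j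
    by blast
  ultimately have "{Inl u, Inl v} \<in> edges (edge_corona G m e H) \<longleftrightarrow> {u, v} \<in> edges G"
    by (auto simp: edge_corona_def image_iff doubleton_eq_iff)
  then show ?thesis by (simp add: adj_entry_def)
qed

lemma edge_corona_adj_cross:
  fixes G :: "'a graph" and H :: "nat \<Rightarrow> 'b graph"
  assumes "i \<in> {1..m}" and "w \<in> verts (H i)"
  shows "adj_entry (edge_corona G m e H) (Inl u) (Inr (i, w)) = (if u \<in> e i then 1 else 0)"
    and "adj_entry (edge_corona G m e H) (Inr (i, w)) (Inl u) = (if u \<in> e i then 1 else 0)"
proof -
  have "{Inl u, Inr (i, w)} \<noteq> (Inl ` d :: ('a + nat \<times> 'b) set)"
    and "{Inl u, Inr (i, w)} \<noteq> ((\<lambda>v. Inr (j, v)) ` d' :: ('a + nat \<times> 'b) set)" for d d' j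
    by blast+
  then have "{Inl u, Inr (i, w)} \<in> edges (edge_corona G m e H) \<longleftrightarrow> u \<in> e i"
    using assms by (auto simp: edge_corona_def image_iff doubleton_eq_iff)
  then show "adj_entry (edge_corona G m e H) (Inl u) (Inr (i, w)) = (if u \<in> e i then 1 else 0)"
    and "adj_entry (edge_corona G m e H) (Inr (i, w)) (Inl u) = (if u \<in> e i then 1 else 0)"
    by (simp_all add: adj_entry_def insert_commute)
qed

lemma edge_corona_adj_attached:
  fixes G :: "'a graph" and H :: "nat \<Rightarrow> 'b graph"
  assumes "i \<in> {1..m}"
  shows "adj_entry (edge_corona G m e H) (Inr (i, v)) (Inr (j, w))
    = (if i = j then adj_entry (H i) v w else 0)"
proof -
  have 1: "{Inr (i, v), Inr (j, w)} \<noteq> (Inl ` d :: ('a + nat \<times> 'b) set)" for d by blast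
  have 2: "{Inr (i, v), Inr (j, w) :: 'a + nat \<times> 'b} = (\<lambda>v. Inr (k, v)) ` d
      \<longleftrightarrow> i = k \<and> j = k \<and> d = {v, w}" for d k
  proof
    assume eq: "{Inr (i, v), Inr (j, w) :: 'a + nat \<times> 'b} = (\<lambda>v. Inr (k, v)) ` d"
    then have "Inr (i, v) \<in> (\<lambda>v. Inr (k, v) :: 'a + nat \<times> 'b) ` d"
      and "Inr (j, w) \<in> (\<lambda>v. Inr (k, v) :: 'a + nat \<times> 'b) ` d" by blast+
    then have ij: "i = k" "j = k" by auto
    have "inj (\<lambda>v. Inr (k, v) :: 'a + nat \<times> 'b)" by (simp add: inj_def)
    from inj_image_eq_iff[OF this, of "{v, w}" d] show "i = k \<and> j = k \<and> d = {v, w}"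
      using eq ij by auto
  qed auto
  have "{Inr (i, v), Inr (j, w)} \<in> edges (edge_corona G m e H) \<longleftrightarrow> i = j \<and> {v, w} \<in> edges (H i)"
    using assms by (auto simp: edge_corona_def image_iff doubleton_eq_iff 1 2)
  then show ?thesis by (simp add: adj_entry_def)
qed

lemma simple_graph_edge_corona:
  fixes G :: "'a graph" and H :: "nat \<Rightarrow> 'b graph"
  assumes G: "simple_graph G" and H: "\<And>i. i \<in> {1..m} \<Longrightarrow> simple_graph (H i)"
    and e: "\<And>i. i \<in> {1..m} \<Longrightarrow> e i \<subseteq> verts G"
  shows "simple_graph (edge_corona G m e H)"
  unfolding simple_graph_def
proof (intro conjI ballI)
  show "finite (verts (edge_corona G m e H))"
    using simple_graphD(1)[OF G] simple_graphD(1)[OF H] by (auto simp: edge_corona_def)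
  fix d assume "d \<in> edges (edge_corona G m e H)"
  then consider (base) c where "c \<in> edges G" "d = Inl ` c"
    | (attached) i c where "i \<in> {1..m}" "c \<in> edges (H i)" "d = (\<lambda>v. Inr (i, v)) ` c"
    | (cross) u i v where "i \<in> {1..m}" "u \<in> e i" "v \<in> verts (H i)" "d = {Inl u, Inr (i, v)}"
    unfolding edge_corona_def by auto
  then have "d \<subseteq> verts (edge_corona G m e H) \<and> card d = 2"
  proof cases
    case base
    then show ?thesis
      using simple_graphD(3,4)[OF G base(1)]
      by (auto simp: edge_corona_def card_image)
  next
    case attached
    have "card ((\<lambda>v. Inr (i, v) :: 'a + nat \<times> 'b) ` c) = card c"
      by (rule card_image) (simp add: inj_on_def)
    moreover have c: "c \<subseteq> verts (H i)" "card c = 2"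
      using simple_graphD(3,4)[OF H[OF attached(1)] attached(2)] by auto
    moreover have "d \<subseteq> verts (edge_corona G m e H)"
      unfolding edge_corona_def graph.simps attached(3) using attached(1) c(1) by blast
    ultimately show ?thesis
      using attached(3) by simp
  next
    case cross
    then show ?thesis using e by (auto simp: edge_corona_def)
  qed
  then show "d \<subseteq> verts (edge_corona G m e H)" "card d = 2" by auto
qed

lemma sum_attached_verts:
  fixes H :: "nat \<Rightarrow> 'b graph"
  assumes "\<And>i. i \<in> {1..m} \<Longrightarrow> finite (verts (H i))"
  shows "(\<Sum>z\<in>(\<Union>i\<in>{1..m}. (\<lambda>v. Inr (i, v)) ` verts (H i)). f z)
    = (\<Sum>i=1..m. \<Sum>v\<in>verts (H i). f (Inr (i, v)))"
proof -
  have "(\<Sum>v\<in>verts (H i). f (Inr (i, v))) = sum f ((\<lambda>v. Inr (i, v)) ` verts (H i))" for i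
    by (subst sum.reindex) (auto simp: inj_on_def)
  moreover have "sum f (\<Union>i\<in>{1..m}. (\<lambda>v. Inr (i, v)) ` verts (H i))
      = (\<Sum>i=1..m. sum f ((\<lambda>v. Inr (i, v)) ` verts (H i)))"
    using assms by (intro sum.UNION_disjoint) auto
  ultimately show ?thesis by simp
qed

lemma sum_edge_corona_verts:
  assumes "finite (verts G)" and "\<And>i. i \<in> {1..m} \<Longrightarrow> finite (verts (H i))"
  shows "(\<Sum>z\<in>verts (edge_corona G m e H). f z)
    = (\<Sum>u\<in>verts G. f (Inl u)) + (\<Sum>i=1..m. \<Sum>v\<in>verts (H i). f (Inr (i, v)))"
proof -
  have "(\<Sum>z\<in>verts (edge_corona G m e H). f z)
      = sum f (Inl ` verts G) + sum f (\<Union>i\<in>{1..m}. (\<lambda>v. Inr (i, v)) ` verts (H i))"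
    unfolding edge_corona_def graph.simps using assms by (intro sum.union_disjoint) auto
  also have "sum f (Inl ` verts G) = (\<Sum>u\<in>verts G. f (Inl u))"
    by (simp add: sum.reindex)
  finally show ?thesis
    by (simp only: sum_attached_verts[OF assms(2)])
qed

lemma sum_alpha_entry:
  assumes "simple_graph G" and "u \<in> verts G"
  shows "(\<Sum>v\<in>verts G. alpha_entry \<alpha> G u v) = real (vdeg G u)"
proof -
  have "(\<Sum>v\<in>verts G. alpha_entry \<alpha> G u v)
      = \<alpha> * real (vdeg G u) + (1 - \<alpha>) * (\<Sum>v\<in>verts G. adj_entry G u v)"
    using simple_graphD(1)[OF assms(1)] assms(2)
    by (simp add: alpha_entry_def sum.distrib sum_distrib_left)
  then show ?thesis by (simp add: sum_adj_entry[OF assms(1)] algebra_simps)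
qed

text \<open>
  Both degrees are read off as row sums of the adjacency matrix of the corona. A vertex \<open>u\<close> of \<open>G\<close>
  keeps its neighbours and gains the \<open>q\<close> vertices attached to each edge at \<open>u\<close>; a vertex of \<open>H i\<close>
  gains the two ends of \<open>e i\<close>.
\<close>
lemma vdeg_edge_corona:
  assumes G: "simple_graph G" and H: "\<And>i. i \<in> {1..m} \<Longrightarrow> simple_graph (H i) \<and> card (verts (H i)) = q"
    and e: "bij_betw e {1..m} (edges G)"
  shows "vdeg (edge_corona G m e H) (Inl u) = vdeg G u * (q + 1)"
    and "i \<in> {1..m} \<Longrightarrow> v \<in> verts (H i)
      \<Longrightarrow> vdeg (edge_corona G m e H) (Inr (i, v)) = vdeg (H i) v + 2"
proof -
  let ?K = "edge_corona G m e H"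
  have eE: "e i \<in> edges G" if "i \<in> {1..m}" for i
    using bij_betwE[OF e] that by blast
  note e_sub = simple_graphD(3)[OF G eE]
  have K: "simple_graph ?K"
    using G H e_sub by (intro simple_graph_edge_corona) auto
  note fin = simple_graphD(1)[OF G] simple_graphD(1)[OF conjunct1[OF H]]
  note deg = sum_adj_entry[OF K, symmetric] 
  have "real (vdeg ?K (Inl u))
      = (\<Sum>v\<in>verts G. adj_entry G u v)
        + (\<Sum>i=1..m. \<Sum>v\<in>verts (H i). if u \<in> e i then 1 else 0)"
    unfolding deg by (subst sum_edge_corona_verts[OF fin])
      (auto simp: edge_corona_adj_base edge_corona_adj_cross intro!: sum.cong)
  also have "(\<Sum>i=1..m. \<Sum>v\<in>verts (H i). if u \<in> e i then 1 else 0 :: real)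
      = (\<Sum>i=1..m. real q * ((if u \<in> e i then 1 else 0) * (if u \<in> e i then 1 else 0)))"
    using H by (intro sum.cong) auto
  also have "\<dots> = real q * real (vdeg G u)"
    unfolding sum_distrib_left[symmetric] sum_incidence[OF G e]
    using simple_graphD(4)[OF G, of "{u}"] by (auto simp: adj_entry_def)
  finally have "real (vdeg ?K (Inl u)) = real (vdeg G u * (q + 1))"
    by (simp add: sum_adj_entry[OF G] algebra_simps)
  then show "vdeg ?K (Inl u) = vdeg G u * (q + 1)" by (simp only: of_nat_eq_iff)
  assume i: "i \<in> {1..m}" and v: "v \<in> verts (H i)"
  have "real (vdeg ?K (Inr (i, v)))
      = (\<Sum>u\<in>verts G. if u \<in> e i then 1 else 0)
        + (\<Sum>j=1..m. \<Sum>w\<in>verts (H j). if i = j then adj_entry (H i) v w else 0)"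
    unfolding deg using i v
    by (subst sum_edge_corona_verts[OF fin])
      (auto simp: edge_corona_adj_attached edge_corona_adj_cross intro!: sum.cong)
  also have "(\<Sum>u\<in>verts G. if u \<in> e i then 1 else 0 :: real) = real (card (e i))"
    using fin(1) e_sub[OF i] by (simp add: sum.If_cases Int_absorb1 Int_commute)
  also have "(\<Sum>j=1..m. \<Sum>w\<in>verts (H j). if i = j then adj_entry (H i) v w else 0)
      = (\<Sum>j=1..m. if i = j then real (vdeg (H i) v) else 0)"
    using H[OF i] by (intro sum.cong) (auto simp: sum_adj_entry)
  finally have "real (vdeg ?K (Inr (i, v))) = real (vdeg (H i) v + 2)"
    using i simple_graphD(4)[OF G eE[OF i]] by simp
  then show "vdeg ?K (Inr (i, v)) = vdeg (H i) v + 2" by (simp only: of_nat_eq_iff)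
qed

section \<open>The characteristic polynomial of the edge corona\<close>

text \<open>
  The identity at a real point \<open>t\<close>, with the denominator cleared. The copies of the \<open>H i\<close> are
  eliminated at once: on the block of \<open>H i\<close> the matrix \<open>t I - A\<^sub>\<alpha>\<close> has constant row sum
  \<open>s = t - 2 \<alpha> - r\<^sub>2\<close>, and each of its columns towards \<open>G\<close> is constant on that block, hence an
  eigenvector for \<open>s\<close>. What remains on \<open>G\<close> is a combination of \<open>I\<close> and \<open>A(G)\<close>, because the eliminated
  terms add up to a multiple of \<open>r\<^sub>1 I + A(G)\<close>.
\<close>
lemma edge_corona_char_poly_eval:
  fixes G :: "'a graph" and H :: "nat \<Rightarrow> 'b graph" and \<alpha> t :: real
  assumes G: "simple_graph G" "regular r\<^sub>1 G"
    and e: "bij_betw e {1..m} (edges G)"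
    and H: "\<And>i. i \<in> {1..m} \<Longrightarrow> simple_graph (H i) \<and> regular r\<^sub>2 (H i) \<and> card (verts (H i)) = q"
  shows "(t - 2 * \<alpha> - real r\<^sub>2) ^ card (verts G) * poly (char_poly (A_alpha \<alpha> (edge_corona G m e H))) t
    = (\<Prod>a\<leftarrow>adj_eigenvalues G.
        (t - 2 * \<alpha> - real r\<^sub>2) * (t - \<alpha> * real r\<^sub>1 * (real q + 1) - (1 - \<alpha>) * a)
        - real q * (1 - \<alpha>)\<^sup>2 * (real r\<^sub>1 + a))
      * (\<Prod>i=1..m. poly (char_poly (A_alpha \<alpha> (H i))) (t - 2 * \<alpha>))"
proof -
  let ?K = "edge_corona G m e H"
  \<comment> \<open>\<open>M\<close> is the kernel of \<open>t I - A\<^sub>\<alpha>\<close> of the corona; the vertices are listed as \<open>G\<close> first (\<open>xs\<close>),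
      then \<open>H 1, ..., H m\<close> (\<open>ys\<close>).\<close>
  define s where "s = t - 2 * \<alpha> - real r\<^sub>2"
  define M where "M = (\<lambda>x y. (if x = y then t else 0) - alpha_entry \<alpha> ?K x y)"
  define block where "block = (\<lambda>i. map (\<lambda>v. Inr (i, v) :: 'a + nat \<times> 'b) (vertex_list (H i)))"
  define xs where "xs = map (Inl :: 'a \<Rightarrow> 'a + nat \<times> 'b) (vertex_list G)"
  define ys where "ys = concat (map block [1..<m + 1])"
  have e_sub: "e i \<subseteq> verts G" if "i \<in> {1..m}" for i
    using bij_betwE[OF e] simple_graphD(3)[OF G(1)] that by blast
  have K: "simple_graph ?K"
    using G H e_sub by (intro simple_graph_edge_corona) auto
  have Hs: "simple_graph (H i)" if "i \<in> {1..m}" for i using H that by blast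
  note finG = simple_graphD(1)[OF G(1)] and finH = simple_graphD(1)[OF Hs]
  note vlG = vertex_list[OF finG] and vlH = vertex_list[OF finH]
  have range: "i \<in> set [1..<m + 1] \<longleftrightarrow> i \<in> {1..m}" for i by auto
  have set_block: "set (block i) = (\<lambda>v. Inr (i, v)) ` verts (H i)" if "i \<in> {1..m}" for i
    unfolding block_def using vlH(2)[OF that] by simp
  have set_ys: "set ys = (\<Union>i\<in>{1..m}. (\<lambda>v. Inr (i, v)) ` verts (H i))"
    unfolding ys_def set_concat set_map by (force simp: set_block)
  have set_xs: "set xs = Inl ` verts G"
    unfolding xs_def using vlG by simp
  have dist_block: "distinct (block i)" if "i \<in> {1..m}" for i
    unfolding block_def using vlH(1)[OF that] by (simp add: distinct_map inj_on_def)
  have "distinct ys"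
  proof -
    have "distinct (concat (map block ks))" if "distinct ks" "set ks \<subseteq> {1..m}" for ks
      using that
    proof (induction ks)
      case (Cons k ks)
      then show ?case using dist_block by (auto simp: block_def)
    qed simp
    moreover have "set [1..<m + 1] \<subseteq> {1..m}" by auto
    ultimately show ?thesis unfolding ys_def using distinct_upt by blast
  qed
  moreover have "distinct xs"
    unfolding xs_def using vlG(1) by (simp add: distinct_map)
  ultimately have dist: "distinct (xs @ ys)"
    by (auto simp: set_xs set_ys)
  have "set (vertex_list ?K) = set (xs @ ys)"
    unfolding vertex_list(2)[OF simple_graphD(1)[OF K]]
    by (simp add: set_xs set_ys edge_corona_def)
  then have reorder: "mset (vertex_list ?K) = mset (xs @ ys)"
    using dist vertex_list(1)[OF simple_graphD(1)[OF K]] set_eq_iff_mset_eq_distinct by blast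

  note deg = vdeg_edge_corona[OF G(1) _ e, of H q]
  have M_base: "M (Inl u) (Inl v)
      = (if u = v then t - \<alpha> * real r\<^sub>1 * (real q + 1) else 0) - (1 - \<alpha>) * adj_entry G u v"
    if "u \<in> verts G" for u v
    using that G(2) H deg(1)
    by (auto simp: M_def alpha_entry_def edge_corona_adj_base regular_def algebra_simps)
  have M_cross: "M (Inl u) (Inr (i, v)) = - (1 - \<alpha>) * (if u \<in> e i then 1 else 0)"
    "M (Inr (i, v)) (Inl u) = - (1 - \<alpha>) * (if u \<in> e i then 1 else 0)"
    if "i \<in> {1..m}" "v \<in> verts (H i)" for u i v
    using that by (simp_all add: M_def alpha_entry_def edge_corona_adj_cross)
  have M_attached: "M (Inr (i, v)) (Inr (j, w))
      = (if i = j then (if v = w then t - 2 * \<alpha> else 0) - alpha_entry \<alpha> (H i) v w else 0)"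
    if "i \<in> {1..m}" "v \<in> verts (H i)" for i j v w
    using that H deg(2)[of i v]
    by (auto simp: M_def alpha_entry_def edge_corona_adj_attached algebra_simps)

  have sum_ys: "(\<Sum>z\<in>set ys. f z) = (\<Sum>i=1..m. \<Sum>v\<in>verts (H i). f (Inr (i, v)))" for f :: "_ \<Rightarrow> real"
    unfolding set_ys by (rule sum_attached_verts) (rule finH)
  have eig: "(\<Sum>z\<in>set ys. M y z * M z x) = s * M y x" if "x \<in> set xs" "y \<in> set ys" for x y
  proof -
    from that obtain u i v where x: "x = Inl u" and y: "y = Inr (i, v)"
      and i: "i \<in> {1..m}" and v: "v \<in> verts (H i)"
      unfolding set_xs set_ys by auto
    have "(\<Sum>z\<in>set ys. M y z * M z x)
        = (\<Sum>j=1..m. if i = j then (\<Sum>w\<in>verts (H i). M y (Inr (i, w)) * M y x) else 0)"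
      unfolding sum_ys x y using i v
      by (intro sum.cong) (auto simp: M_attached M_cross intro!: sum.cong)
    also have "\<dots> = (\<Sum>w\<in>verts (H i). M y (Inr (i, w))) * M y x"
      using i by (simp add: sum_distrib_right)
    also have "(\<Sum>w\<in>verts (H i). M y (Inr (i, w)))
        = (\<Sum>w\<in>verts (H i). if v = w then t - 2 * \<alpha> else 0)
          - (\<Sum>w\<in>verts (H i). alpha_entry \<alpha> (H i) v w)"
      unfolding y using i v by (simp add: M_attached sum_subtractf)
    also have "\<dots> = s"
      using H[OF i] finH[OF i] v by (simp add: sum_alpha_entry s_def regular_def)
    finally show ?thesis .
  qed
  \<comment> \<open>The \<open>q\<close> vertices of each \<open>H i\<close> contribute equally, which is where the factor \<open>q\<close> comes from.\<close>
  have schur: "s * M (Inl u) (Inl v) - (\<Sum>z\<in>set ys. M (Inl u) z * M z (Inl v))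
      = (if u = v then s * (t - \<alpha> * real r\<^sub>1 * (real q + 1)) - real q * (1 - \<alpha>)\<^sup>2 * real r\<^sub>1 else 0)
        - (s * (1 - \<alpha>) + real q * (1 - \<alpha>)\<^sup>2) * adj_entry G u v"
    if "u \<in> verts G" for u v
  proof -
    have "(\<Sum>z\<in>set ys. M (Inl u) z * M z (Inl v))
        = (\<Sum>i=1..m. real q * (1 - \<alpha>)\<^sup>2 * ((if u \<in> e i then 1 else 0) * (if v \<in> e i then 1 else 0)))"
      unfolding sum_ys using H by (intro sum.cong) (auto simp: M_cross power2_eq_square algebra_simps)
    also have "\<dots> = real q * (1 - \<alpha>)\<^sup>2 * ((if u = v then real r\<^sub>1 else 0) + adj_entry G u v)"
      unfolding sum_distrib_left[symmetric] sum_incidence[OF G(1) e]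
      using G(2) that by (auto simp: regular_def)
    finally show ?thesis
      using that by (simp add: M_base algebra_simps)
  qed

  have "poly (char_poly (A_alpha \<alpha> ?K)) t = indexed_det (xs @ ys) M"
    unfolding poly_char_poly_A_alpha[OF simple_graphD(1)[OF K]] M_def
    by (rule indexed_det_reorder[OF reorder])
  moreover have "length xs = card (verts G)"
    unfolding xs_def using vlG(3) by simp
  ultimately have "s ^ card (verts G) * poly (char_poly (A_alpha \<alpha> ?K)) t
      = indexed_det xs (\<lambda>x y. s * M x y - (\<Sum>z\<in>set ys. M x z * M z y)) * indexed_det ys M"
    using indexed_det_eliminate[OF dist eig] by simp
  also have "indexed_det xs (\<lambda>x y. s * M x y - (\<Sum>z\<in>set ys. M x z * M z y))
      = (\<Prod>a\<leftarrow>adj_eigenvalues G. s * (t - \<alpha> * real r\<^sub>1 * (real q + 1)) - real q * (1 - \<alpha>)\<^sup>2 * real r\<^sub>1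
          - (s * (1 - \<alpha>) + real q * (1 - \<alpha>)\<^sup>2) * a)"
    unfolding xs_def indexed_det_map indexed_det_adj_linear[OF G(1), symmetric]
    by (rule indexed_det_cong) (simp add: schur vlG(2))
  also have "\<dots> = (\<Prod>a\<leftarrow>adj_eigenvalues G.
        s * (t - \<alpha> * real r\<^sub>1 * (real q + 1) - (1 - \<alpha>) * a) - real q * (1 - \<alpha>)\<^sup>2 * (real r\<^sub>1 + a))"
    by (simp add: algebra_simps)
  also have "indexed_det ys M = (\<Prod>i\<in>{1..m}. indexed_det (block i) M)"
  proof -
    have "indexed_det ys M = (\<Prod>i\<in>set [1..<m + 1]. indexed_det (block i) M)"
      unfolding ys_def
      by (rule indexed_det_concat) (auto simp: range set_block M_attached simp del: upt_Suc)
    moreover have "set [1..<m + 1] = {1..m}" by auto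
    ultimately show ?thesis by (simp only:)
  qed
  also have "\<dots> = (\<Prod>i=1..m. poly (char_poly (A_alpha \<alpha> (H i))) (t - 2 * \<alpha>))"
  proof (rule prod.cong[OF refl])
    fix i assume i: "i \<in> {1..m}"
    show "indexed_det (block i) M = poly (char_poly (A_alpha \<alpha> (H i))) (t - 2 * \<alpha>)"
      unfolding block_def indexed_det_map poly_char_poly_A_alpha[OF finH[OF i]]
      using M_attached[OF i] by (intro indexed_det_cong) (simp add: vlH(2)[OF i])
  qed
  finally show ?thesis unfolding s_def .
qed

lemma prod_adj_eigenvalues:
  fixes f :: "real \<Rightarrow> 'b :: comm_monoid_mult"
  assumes "simple_graph G"
  shows "(\<Prod>a\<leftarrow>adj_eigenvalues G. f a) = (\<Prod>j=1..card (verts G). f (adj_eigenvalue G j))"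
proof -
  have "(\<Prod>a\<leftarrow>as. f a) = (\<Prod>j=1..length as. f (as ! (j - 1)))" for as
    by (induction as rule: rev_induct) (auto simp: nth_append intro!: arg_cong2[of _ _ _ _ "(*)"] prod.cong)
  then show ?thesis
    unfolding adj_eigenvalue_def using adj_char_poly_splits(2)[OF assms] by simp
qed

theorem theorem4p1:
  fixes G :: "'a graph" and H :: "nat \<Rightarrow> 'b graph" and e :: "nat \<Rightarrow> 'a set"
    and n m q r\<^sub>1 r\<^sub>2 :: nat and \<alpha> :: real
  assumes "simple_graph G" and "regular r\<^sub>1 G" and "card (verts G) = n"
    and "bij_betw e {1..m} (edges G)"
    and "\<And>i. i \<in> {1..m} \<Longrightarrow> simple_graph (H i) \<and> regular r\<^sub>2 (H i) \<and> card (verts (H i)) = q"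
    and "0 \<le> \<alpha>" and "\<alpha> \<le> 1"
  shows "length (adj_eigenvalues G) = n \<and>
    (n > 0 \<longrightarrow> adj_eigenvalue G n = real r\<^sub>1) \<and>
    to_fract (char_poly (A_alpha \<alpha> (edge_corona G m e H))) =
      1 / to_fract [:- (2 * \<alpha> + real r\<^sub>2), 1:] ^ n
      * (\<Prod>i=1..m. to_fract (pcompose (char_poly (A_alpha \<alpha> (H i))) [:- (2 * \<alpha>), 1:]))
      * (\<Prod>j=1..n. to_fract
          [: (2 * \<alpha> + real r\<^sub>2) * (\<alpha> * real r\<^sub>1 * (real q + 1) + (1 - \<alpha>) * adj_eigenvalue G j)
               - real q * (1 - \<alpha>)\<^sup>2 * (real r\<^sub>1 + adj_eigenvalue G j),
             - (2 * \<alpha> + real r\<^sub>2 + \<alpha> * real r\<^sub>1 * (real q + 1) + (1 - \<alpha>) * adj_eigenvalue G j),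
             1 :])"
proof (intro conjI impI)
  show "length (adj_eigenvalues G) = n"
    using adj_char_poly_splits(2)[OF assms(1)] assms(3) by simp
  show "adj_eigenvalue G n = real r\<^sub>1" if "n > 0"
    using regular_largest_eigenvalue[OF assms(1,2)] that assms(3) by simp
  let ?d = "[:- (2 * \<alpha> + real r\<^sub>2), 1:]"
  let ?p = "char_poly (A_alpha \<alpha> (edge_corona G m e H))"
  let ?h = "\<lambda>i. pcompose (char_poly (A_alpha \<alpha> (H i))) [:- (2 * \<alpha>), 1:]"
  let ?g = "\<lambda>j. [: (2 * \<alpha> + real r\<^sub>2) * (\<alpha> * real r\<^sub>1 * (real q + 1) + (1 - \<alpha>) * adj_eigenvalue G j)
               - real q * (1 - \<alpha>)\<^sup>2 * (real r\<^sub>1 + adj_eigenvalue G j),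
             - (2 * \<alpha> + real r\<^sub>2 + \<alpha> * real r\<^sub>1 * (real q + 1) + (1 - \<alpha>) * adj_eigenvalue G j),
             1 :]"
  \<comment> \<open>Real polynomials that agree at every real point are equal, so it suffices to evaluate.\<close>
  have "poly (?d ^ n * ?p) t = poly ((\<Prod>i=1..m. ?h i) * (\<Prod>j=1..n. ?g j)) t" for t
  proof -
    have "poly (?d ^ n * ?p) t = (t - 2 * \<alpha> - real r\<^sub>2) ^ card (verts G) * poly ?p t"
      using assms(3) by (simp add: algebra_simps)
    also have "\<dots> = (\<Prod>j=1..card (verts G).
          (t - 2 * \<alpha> - real r\<^sub>2) * (t - \<alpha> * real r\<^sub>1 * (real q + 1) - (1 - \<alpha>) * adj_eigenvalue G j)
          - real q * (1 - \<alpha>)\<^sup>2 * (real r\<^sub>1 + adj_eigenvalue G j))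
        * (\<Prod>i=1..m. poly (char_poly (A_alpha \<alpha> (H i))) (t - 2 * \<alpha>))"
      using edge_corona_char_poly_eval[where H = H and q = q and r\<^sub>2 = r\<^sub>2, OF assms(1,2,4,5), of t \<alpha>]
      unfolding prod_adj_eigenvalues[OF assms(1)] .
    also have "\<dots> = (\<Prod>j=1..n. poly (?g j) t) * (\<Prod>i=1..m. poly (?h i) t)"
      unfolding assms(3)
      by (intro arg_cong2[of _ _ _ _ "(*)"] prod.cong refl)
         (simp_all add: poly_pcompose algebra_simps power2_eq_square)
    finally show ?thesis by (simp only: poly_mult poly_prod mult.commute)
  qed
  then have "?d ^ n * ?p = (\<Prod>i=1..m. ?h i) * (\<Prod>j=1..n. ?g j)"
    by (rule poly_eq_poly_eq_iff[THEN iffD1, OF ext])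
  then have eq: "to_fract (?d ^ n * ?p) = to_fract ((\<Prod>i=1..m. ?h i) * (\<Prod>j=1..n. ?g j))"
    by (simp only:)
  have to_fract_prod: "to_fract (\<Prod>i\<in>A. f i) = (\<Prod>i\<in>A. to_fract (f i))"
    for A :: "nat set" and f :: "nat \<Rightarrow> real poly"
    by (induction A rule: infinite_finite_induct) auto
  have to_fract_power: "to_fract (p ^ k) = to_fract p ^ k" for p :: "real poly" and k
    by (induction k) auto
  have divide: "P = 1 / D * x * y" if "D * P = x * y" "D \<noteq> 0" for D P x y :: "real poly fract"
    using that by (simp add: field_simps)
  show "to_fract ?p = 1 / to_fract ?d ^ n * (\<Prod>i=1..m. to_fract (?h i)) * (\<Prod>j=1..n. to_fract (?g j))"
    using eq unfolding to_fract_mult to_fract_prod to_fract_power by (rule divide) simp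
qed

end
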